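(* Let $k,l,p$ be positive integers and let $m,n$ be nonnegative integers. Then the following identities hold in $\mathfrak{h}^1$: $$z_k z_p^m\ast z_l z_p^n=\sum_{i=1}^m z_k (z_p^{i}z_l+z_p^{i-1}z_{p+l})(z_p^{m-i}\ast z_p^n)+\sum_{i=1}^{n}z_l (z_p^{i}z_k+z_p^{i-1}z_{p+k})(z_p^{n-i}\ast z_p^m)+(z_k z_l+z_l z_k+z_{k+l})(z_p^m\ast z_p^n)$$ and $$z_k z_p^m\,\bar{\ast}\, z_l z_p^n=\sum_{i=1}^m z_k (z_p^{i}z_l-z_p^{i-1}z_{p+l})(z_p^{m-i}\,\bar{\ast}\, z_p^n)+\sum_{i=1}^{n}z_l (z_p^{i}z_k-z_p^{i-1}z_{p+k})(z_p^{n-i}\,\bar{\ast}\, z_p^m)+(z_k z_l+z_l z_k-z_{k+l})(z_p^m\,\bar{\ast}\, z_p^n).$$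
   Context: Let $Y=\{z_k\mid k=1,2,\ldots\}$ be an alphabet of noncommuting letters, $Y^{\ast}$ the set of all words in the letters of $Y$ (including the empty word $1$), and $\mathfrak{h}^1=\mathbb{Q}\langle Y\rangle$ the noncommutative polynomial algebra over $\mathbb{Q}$ generated by $Y$; it has $Y^{\ast}$ as a $\mathbb{Q}$-basis, and juxtaposition denotes the concatenation product, so $z_p^m$ is the word $z_p\cdots z_p$ with $m$ letters ($z_p^0=1$). The two stuffle products $\ast$ and $\bar{\ast}$ are the $\mathbb{Q}$-bilinear products on $\mathfrak{h}^1$ defined recursively by $$1\ast w=w\ast 1=w,\qquad z_kw_1\ast z_lw_2=z_k(w_1\ast z_lw_2)+z_l(z_kw_1\ast w_2)+z_{k+l}(w_1\ast w_2),$$ $$1\,\bar{\ast}\, w=w\,\bar{\ast}\, 1=w,\qquad z_kw_1\,\bar{\ast}\, z_lw_2=z_k(w_1\,\bar{\ast}\, z_lw_2)+z_l(z_kw_1\,\bar{\ast}\, w_2)-z_{k+l}(w_1\,\bar{\ast}\, w_2),$$ for all words $w,w_1,w_2\in Y^{\ast}$ and positive integers $k,l$. Both products are commutative and associative. *)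

theory Defs
  imports Complex_Main "HOL-Library.Poly_Mapping"
begin

text \<open>The alphabet \<open>Y = {z\<^sub>k | k \<ge> 1}\<close>; a letter is identified with its index.\<close>

typedef letter = "{k::nat. 0 < k}"
  morphisms index letter_of
  by auto

definition add_index :: "letter \<Rightarrow> letter \<Rightarrow> letter"
  where "add_index a b = letter_of (index a + index b)"

text \<open>
  Words over \<open>Y\<close>. The convolution product of \<^theory>\<open>HOL-Library.Poly_Mapping\<close> expects the monoid
  of exponents to be written additively, so the free monoid is presented with \<open>0\<close> as the empty
  word and the (noncommutative) \<open>+\<close> as concatenation. The type of finitely supported functions
  from words to the rationals is then the noncommutative polynomial algebra, in which \<open>*\<close> and \<open>^\<close>
  are concatenation and its powers, and \<open>1\<close> is the empty word.
\<close>

datatype word = Word (letters: "letter list")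

instantiation word :: monoid_add
begin

definition zero_word :: word
  where "0 = Word []"

definition plus_word :: "word \<Rightarrow> word \<Rightarrow> word"
  where "u + v = Word (letters u @ letters v)"

instance
  by standard (simp_all add: zero_word_def plus_word_def)

end

type_synonym h1 = "word \<Rightarrow>\<^sub>0 rat"

definition of_word :: "letter list \<Rightarrow> h1"
  where "of_word w = Poly_Mapping.single (Word w) 1"

text \<open>The generator \<open>z\<^sub>k\<close>; only meaningful for \<open>k > 0\<close>.\<close>

definition z :: "nat \<Rightarrow> h1"
  where "z k = of_word [letter_of k]"

fun stuffle_words :: "letter list \<Rightarrow> letter list \<Rightarrow> h1"
  where
    "stuffle_words [] w = of_word w"
  | "stuffle_words w [] = of_word w"
  | "stuffle_words (a # u) (b # v) =
       of_word [a] * stuffle_words u (b # v)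
     + of_word [b] * stuffle_words (a # u) v
     + of_word [add_index a b] * stuffle_words u v"

fun stuffle_bar_words :: "letter list \<Rightarrow> letter list \<Rightarrow> h1"
  where
    "stuffle_bar_words [] w = of_word w"
  | "stuffle_bar_words w [] = of_word w"
  | "stuffle_bar_words (a # u) (b # v) =
       of_word [a] * stuffle_bar_words u (b # v)
     + of_word [b] * stuffle_bar_words (a # u) v
     - of_word [add_index a b] * stuffle_bar_words u v"

text \<open>Multiplication by the constant polynomial \<open>single 0 c\<close> is scaling by the rational \<open>c\<close>.\<close>

definition bilinear_extension :: "(letter list \<Rightarrow> letter list \<Rightarrow> h1) \<Rightarrow> h1 \<Rightarrow> h1 \<Rightarrow> h1"
  where "bilinear_extension B f g =
    (\<Sum>u\<in>Poly_Mapping.keys f. \<Sum>v\<in>Poly_Mapping.keys g.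
      Poly_Mapping.single 0 (Poly_Mapping.lookup f u * Poly_Mapping.lookup g v)
        * B (letters u) (letters v))"

definition stuffle :: "h1 \<Rightarrow> h1 \<Rightarrow> h1"  (infixl "\<star>" 68)
  where "f \<star> g = bilinear_extension stuffle_words f g"

definition stuffle_bar :: "h1 \<Rightarrow> h1 \<Rightarrow> h1"  (infixl "\<star>\<^sub>-" 68)
  where "f \<star>\<^sub>- g = bilinear_extension stuffle_bar_words f g"

lemma bilinear_extension_of_word [simp]:
  "bilinear_extension B (of_word u) (of_word v) = B u v"
  by (simp add: bilinear_extension_def of_word_def)

lemma of_word_Nil: "of_word [] = 1"
  by (simp add: of_word_def flip: single_one zero_word_def)

lemma of_word_Cons: "of_word (a # w) = of_word [a] * of_word w"
  by (simp add: of_word_def mult_single plus_word_def)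

lemma z_add: "0 < k \<Longrightarrow> 0 < l \<Longrightarrow> of_word [add_index (letter_of k) (letter_of l)] = z (k + l)"
  by (simp add: z_def add_index_def letter_of_inverse)

lemma stuffle_rec:
  assumes "0 < k" "0 < l"
  shows "z k * of_word u \<star> z l * of_word v =
    z k * (of_word u \<star> z l * of_word v) + z l * (z k * of_word u \<star> of_word v)
    + z (k + l) * (of_word u \<star> of_word v)"
  using z_add[OF assms] by (simp add: z_def stuffle_def flip: of_word_Cons)

lemma stuffle_bar_rec:
  assumes "0 < k" "0 < l"
  shows "z k * of_word u \<star>\<^sub>- z l * of_word v =
    z k * (of_word u \<star>\<^sub>- z l * of_word v) + z l * (z k * of_word u \<star>\<^sub>- of_word v)
    - z (k + l) * (of_word u \<star>\<^sub>- of_word v)"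
  using z_add[OF assms] by (simp add: z_def stuffle_bar_def flip: of_word_Cons)

end

theory Submission
  imports Defs
begin

text \<open>
  Both products are instances of one recursion, a quasi-shuffle product, whose third term merges
  the two leading letters \<open>a\<close>, \<open>b\<close> into a prescribed element \<open>d a b\<close>; here \<open>d a b\<close> is
  \<open>\<plusminus> z\<^bsub>a+b\<^esub>\<close>. The proof works for every symmetric \<open>d\<close>.

  The key point is the product of a power \<open>p\<^sup>m\<close> with \<open>b p\<^sup>n\<close>. The single letter \<open>b\<close> must
  appear somewhere in each resulting word, either as itself or merged with a \<open>p\<close> of \<open>p\<^sup>m\<close>. No
  letter of \<open>p\<^sup>n\<close> can precede it, so what precedes is a power of \<open>p\<close>, and what follows is the
  product of the unused part of \<open>p\<^sup>m\<close> with \<open>p\<^sup>n\<close>. Sorting by the position of \<open>b\<close> gives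
  lemma \<open>power_Cons_power\<close>. One step of the recursion for \<open>a p\<^sup>m\<close> and \<open>b p\<^sup>n\<close> reduces to
  such products, up to commutativity: if \<open>a\<close> comes first, the remainder is \<open>p\<^sup>m\<close> times
  \<open>b p\<^sup>n\<close>; if \<open>b\<close> comes first, it is \<open>a p\<^sup>m\<close> times \<open>p\<^sup>n\<close>; if they merge, it is
  \<open>p\<^sup>m\<close> times \<open>p\<^sup>n\<close>. The last terms, together with those in which \<open>a\<close> and \<open>b\<close> are the
  first two letters, form the multiple of \<open>p\<^sup>m\<close> times \<open>p\<^sup>n\<close> that stands outside the sums.
\<close>

locale quasi_shuffle =
  fixes d :: "letter \<Rightarrow> letter \<Rightarrow> h1"
    and B :: "letter list \<Rightarrow> letter list \<Rightarrow> h1"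
  assumes d_commute: "d a b = d b a"
    and Nil_left: "B [] w = of_word w"
    and Nil_right: "B w [] = of_word w"
    and Cons_Cons: "B (a # u) (b # v) =
      of_word [a] * B u (b # v) + of_word [b] * B (a # u) v + d a b * B u v"
begin

lemma commute: "B u v = B v u"
proof (induction "length u + length v" arbitrary: u v rule: less_induct)
  case less
  show ?case
  proof (cases "u = [] \<or> v = []")
    case True
    then show ?thesis by (auto simp: Nil_left Nil_right)
  next
    case False
    then obtain a u' b v' where uv: "u = a # u'" "v = b # v'"
      by (meson neq_Nil_conv)
    have "B u' (b # v') = B (b # v') u'" "B (a # u') v' = B v' (a # u')" "B u' v' = B v' u'"
      by (rule less; simp add: uv)+
    then show ?thesis
      by (simp add: uv Cons_Cons d_commute[of a b] add.commute)
  qed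
qed

text \<open>
  The summand for \<open>i\<close> collects the words in which \<open>b\<close> is reached after \<open>i\<close> letters of \<open>p\<^sup>m\<close> have
  been used, the last of them being merged with \<open>b\<close> in the second part of the summand; the
  leading term is the case where \<open>b\<close> comes first. The recursion for \<open>p\<^sup>m\<^sup>+\<^sup>1\<close> either puts another
  \<open>p\<close> in front, which shifts \<open>i\<close>, or creates the terms with \<open>b\<close> in front or merged with the
  first \<open>p\<close>.
\<close>

lemma power_Cons_power:
  "B (replicate m p) (b # replicate n p) =
     of_word [b] * B (replicate m p) (replicate n p)
   + (\<Sum>i=1..m. (of_word [p] ^ i * of_word [b] + of_word [p] ^ (i - 1) * d p b)
         * B (replicate (m - i) p) (replicate n p))"
proof (induction m)
  case 0
  show ?case by (simp add: Nil_left of_word_Cons[of b "replicate n p"])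
next
  case (Suc m)
  define f where "f M i = (of_word [p] ^ i * of_word [b] + of_word [p] ^ (i - 1) * d p b)
         * B (replicate (M - i) p) (replicate n p)" for M i
  have "f (Suc m) (Suc i) = of_word [p] * f m i" if "i \<in> {1..m}" for i
    using that by (cases i) (simp_all add: f_def algebra_simps)
  then have "(\<Sum>i=1..m. f (Suc m) (Suc i)) = of_word [p] * (\<Sum>i=1..m. f m i)"
    by (simp add: sum_distrib_left)
  moreover have "(\<Sum>i=1..Suc m. f (Suc m) i) = f (Suc m) 1 + (\<Sum>i=1..m. f (Suc m) (Suc i))"
    using sum.atLeast_Suc_atMost[of 1 "Suc m" "f (Suc m)"]
      sum.shift_bounds_cl_Suc_ivl[of "f (Suc m)" 1 m] by simp
  moreover have "f (Suc m) 1 =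
      (of_word [p] * of_word [b] + d p b) * B (replicate m p) (replicate n p)"
    by (simp add: f_def)
  moreover note Suc.IH[folded f_def]
  ultimately show ?case
    unfolding f_def[symmetric] by (simp add: Cons_Cons algebra_simps)
qed

theorem Cons_power_Cons_power:
  "B (a # replicate m p) (b # replicate n p) =
     (\<Sum>i=1..m. of_word [a] * (of_word [p] ^ i * of_word [b] + of_word [p] ^ (i - 1) * d p b)
         * B (replicate (m - i) p) (replicate n p))
   + (\<Sum>i=1..n. of_word [b] * (of_word [p] ^ i * of_word [a] + of_word [p] ^ (i - 1) * d p a)
         * B (replicate (n - i) p) (replicate m p))
   + (of_word [a] * of_word [b] + of_word [b] * of_word [a] + d a b)
         * B (replicate m p) (replicate n p)"
  unfolding Cons_Cons commute[of "a # replicate m p" "replicate n p"] power_Cons_power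
    commute[of "replicate n p" "replicate m p"]
  by (simp add: algebra_simps sum_distrib_left sum.distrib)

end

lemma add_index_commute: "add_index a b = add_index b a"
  by (simp add: add_index_def add.commute)

interpretation stuffle: quasi_shuffle "\<lambda>a b. of_word [add_index a b]" stuffle_words
proof
  show "stuffle_words w [] = of_word w" for w
    by (cases w) simp_all
qed (simp_all add: add_index_commute)

interpretation stuffle_bar: quasi_shuffle "\<lambda>a b. - of_word [add_index a b]" stuffle_bar_words
proof
  show "stuffle_bar_words w [] = of_word w" for w
    by (cases w) simp_all
qed (simp_all add: add_index_commute)

lemma z_power: "z p ^ m = of_word (replicate m (letter_of p))"
  by (induction m)
    (simp_all add: z_def of_word_Nil of_word_Cons[of "letter_of p" "replicate _ _"])

lemma z_mult_power: "z k * z p ^ m = of_word (letter_of k # replicate m (letter_of p))"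
  unfolding z_power of_word_Cons[of "letter_of k" "replicate m _"] by (simp add: z_def)

theorem corollary1p3:
  fixes k l p m n :: nat
  assumes "0 < k" and "0 < l" and "0 < p"
  shows "(z k * z p ^ m \<star> z l * z p ^ n =
      (\<Sum>i=1..m. z k * (z p ^ i * z l + z p ^ (i - 1) * z (p + l)) * (z p ^ (m - i) \<star> z p ^ n))
    + (\<Sum>i=1..n. z l * (z p ^ i * z k + z p ^ (i - 1) * z (p + k)) * (z p ^ (n - i) \<star> z p ^ m))
    + (z k * z l + z l * z k + z (k + l)) * (z p ^ m \<star> z p ^ n))
  \<and> (z k * z p ^ m \<star>\<^sub>- z l * z p ^ n =
      (\<Sum>i=1..m. z k * (z p ^ i * z l - z p ^ (i - 1) * z (p + l)) * (z p ^ (m - i) \<star>\<^sub>- z p ^ n))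
    + (\<Sum>i=1..n. z l * (z p ^ i * z k - z p ^ (i - 1) * z (p + k)) * (z p ^ (n - i) \<star>\<^sub>- z p ^ m))
    + (z k * z l + z l * z k - z (k + l)) * (z p ^ m \<star>\<^sub>- z p ^ n))"
proof
  have z_eq: "of_word [letter_of j] = z j" for j
    by (simp add: z_def)
  have star: "of_word u \<star> of_word v = stuffle_words u v"
    and star_bar: "of_word u \<star>\<^sub>- of_word v = stuffle_bar_words u v" for u v
    by (simp_all add: stuffle_def stuffle_bar_def)
  have star_power: "stuffle_words (replicate i (letter_of p)) (replicate j (letter_of p))
      = z p ^ i \<star> z p ^ j"
    and star_bar_power: "stuffle_bar_words (replicate i (letter_of p)) (replicate j (letter_of p))
      = z p ^ i \<star>\<^sub>- z p ^ j" for i j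
    by (simp_all add: z_power star star_bar)
  note z_sum = z_add[OF assms(1,2)] z_add[OF assms(3,1)] z_add[OF assms(3,2)]
  show "z k * z p ^ m \<star> z l * z p ^ n =
      (\<Sum>i=1..m. z k * (z p ^ i * z l + z p ^ (i - 1) * z (p + l)) * (z p ^ (m - i) \<star> z p ^ n))
    + (\<Sum>i=1..n. z l * (z p ^ i * z k + z p ^ (i - 1) * z (p + k)) * (z p ^ (n - i) \<star> z p ^ m))
    + (z k * z l + z l * z k + z (k + l)) * (z p ^ m \<star> z p ^ n)"
    unfolding z_mult_power[of k] z_mult_power[of l] star stuffle.Cons_power_Cons_power
      z_sum z_eq star_power ..
  show "z k * z p ^ m \<star>\<^sub>- z l * z p ^ n =
      (\<Sum>i=1..m. z k * (z p ^ i * z l - z p ^ (i - 1) * z (p + l)) * (z p ^ (m - i) \<star>\<^sub>- z p ^ n))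
    + (\<Sum>i=1..n. z l * (z p ^ i * z k - z p ^ (i - 1) * z (p + k)) * (z p ^ (n - i) \<star>\<^sub>- z p ^ m))
    + (z k * z l + z l * z k - z (k + l)) * (z p ^ m \<star>\<^sub>- z p ^ n)"
    unfolding z_mult_power[of k] z_mult_power[of l] star_bar stuffle_bar.Cons_power_Cons_power
      z_sum z_eq star_bar_power mult_minus_right add_uminus_conv_diff ..
qed

end
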